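(* Let $\mu$ be a probability measure supported on a subset $F$ of $[0,1]$. Let $\mathcal{A}=(q_n)_{n\in\mathbb{N}}$ be a sequence of natural numbers. Let $\gamma\in[0,1]$ and let $\psi:\mathbb{N}\to[0,1]$ be a real, positive function. Suppose that at least one of the following two conditions holds: $$\sum_{n=1}^\infty\max_{k\in\mathbb{Z}\setminus\{0\}}|\widehat{\mu}(kq_n)|<\infty,\qquad\text{or}\qquad \sum_{n=1}^\infty\sum_{k\in\mathbb{Z}\setminus\{0\}}\frac{|\widehat{\mu}(kq_n)|}{|k|}<\infty.$$ Then $\mu(W_{\mathcal{A}}(\gamma;\psi))=0$ if $\sum_{n=1}^\infty\psi(q_n)<\infty$.
   Context: $\widehat{\mu}(t)=\int e^{-2\pi i t x}\,d\mu(x)$. $\|\alpha\|$ denotes the distance from $\alpha\in\mathbb{R}$ to the nearest integer. $W_{\mathcal{A}}(\gamma;\psi):=\{x\in[0,1]:\ \|q_nx-\gamma\|\le\psi(q_n)\text{ for infinitely many } n\in\mathbb{N}\}$. *)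

theory Defs
  imports "HOL-Probability.Probability"
begin

definition fourier_transform :: "real measure \<Rightarrow> real \<Rightarrow> complex" where
  "fourier_transform \<mu> t =
     (LINT x|\<mu>. exp (- 2 * complex_of_real pi * \<i> * complex_of_real t * complex_of_real x))"

definition dist_nearest_int :: "real \<Rightarrow> real" where
  "dist_nearest_int \<alpha> = infdist \<alpha> \<int>"

text \<open>
  Almost sure membership makes sense for arbitrary, possibly non-measurable \<open>F\<close>: the complement
  of \<open>F\<close> is contained in a null set. It also covers measures whose topological support lies
  in \<open>F\<close>.
\<close>
definition supported_on :: "real measure \<Rightarrow> real set \<Rightarrow> bool" where
  "supported_on \<mu> F \<longleftrightarrow> (AE x in \<mu>. x \<in> F)"

text \<open>
  The sequence \<open>\<A> = (q\<^sub>n)\<close> is given as a function, indexed from \<open>0\<close>; repetitions are allowed, and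
  ``infinitely many'' refers to indices \<open>n\<close>.
\<close>
definition W_set :: "(nat \<Rightarrow> nat) \<Rightarrow> real \<Rightarrow> (nat \<Rightarrow> real) \<Rightarrow> real set" where
  "W_set q \<gamma> \<psi> =
     {x \<in> {0..1}. \<exists>\<^sub>\<infinity>n. dist_nearest_int (real (q n) * x - \<gamma>) \<le> \<psi> (q n)}"

text \<open>
  The supremum is over a nonempty set of reals bounded above by \<open>1\<close> when \<open>\<mu>\<close> is a probability measure.
  It stands for the maximum, which need not be attained in general.
\<close>
definition sup_condition :: "real measure \<Rightarrow> (nat \<Rightarrow> nat) \<Rightarrow> bool" where
  "sup_condition \<mu> q \<longleftrightarrow>
     summable (\<lambda>n. SUP k\<in>UNIV - {0::int}. norm (fourier_transform \<mu> (of_int k * real (q n))))"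

text \<open>
  Finiteness of the iterated series of nonnegative terms: every inner series converges, and so does
  the series of the inner sums. The inner summability is explicit because a divergent
  \<^const>\<open>infsum\<close> has the value \<open>0\<close>.
\<close>
definition weighted_sum_condition :: "real measure \<Rightarrow> (nat \<Rightarrow> nat) \<Rightarrow> bool" where
  "weighted_sum_condition \<mu> q \<longleftrightarrow>
     (\<forall>n. (\<lambda>k::int. norm (fourier_transform \<mu> (of_int k * real (q n))) / of_int \<bar>k\<bar>)
            summable_on (UNIV - {0})) \<and>
     summable (\<lambda>n. \<Sum>\<^sub>\<infinity>k\<in>UNIV - {0::int}.
                norm (fourier_transform \<mu> (of_int k * real (q n))) / of_int \<bar>k\<bar>)"

end

theory Submission
  imports Defs
begin

text \<open>
  For \<open>N \<delta> \<le> 1/6\<close> the kernel \<open>4 \<bar>N\<^sup>-\<^sup>1 \<Sum>\<^bsub>j<N\<^esub> e(j y)\<bar>\<^sup>2\<close> dominates the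
  indicator of \<open>\<parallel>y\<parallel> \<le> \<delta>\<close>, since all the \<open>e(j y)\<close> then have real part at least \<open>1/2\<close>. Putting
  \<open>y = q\<^sub>n x - \<gamma>\<close>, expanding the square and integrating gives
  \<open>\<mu>(\<parallel>q\<^sub>n x - \<gamma>\<parallel> \<le> \<delta>) \<le> 4/N + 4 N\<^sup>-\<^sup>2 \<Sum>\<^bsub>j\<noteq>l\<^esub> \<bar>\<mu>^((l-j) q\<^sub>n)\<bar>\<close>. The last sum is at most
  \<open>N\<^sup>2\<close> times either of the two quantities in the hypotheses (for the weighted one because
  \<open>\<bar>l-j\<bar> \<le> N\<close>). With \<open>N\<close> of order \<open>1/\<delta>\<close> the measures are summable, and Borel--Cantelli applies.
\<close>

lemma norm_sum_cis_ge:
  assumes "dist_nearest_int y \<le> \<delta>" and "real N * \<delta> \<le> 1/6"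
  shows "real N / 2 \<le> norm (\<Sum>j<N. cis (2 * pi * real j * y))"
proof -
  \<comment> \<open>The infimum in \<open>infdist\<close> over a closed nonempty set is attained, so
    an actual integer \<open>k\<close> lies within \<open>\<delta>\<close> of
    \<open>y\<close>.\<close>
  have "closed (\<int> :: real set)" "(\<int> :: real set) \<noteq> {}"
    using Ints_0 by (blast intro: closed_Ints)+
  from infdist_attains_inf[OF this, of y] obtain m
    where "m \<in> (\<int> :: real set)" "infdist y \<int> = dist y m" by blast
  then obtain k :: int where k: "\<bar>y - of_int k\<bar> \<le> \<delta>"
    using assms(1) by (auto simp: dist_nearest_int_def dist_real_def elim!: Ints_cases)
  have cos_ge: "1/2 \<le> cos (2 * pi * real j * y)" if "j < N" for j
  proof -
    \<comment> \<open>This is the phase reduced by the multiple \<open>j * k\<close> of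
      \<open>2 * pi\<close>. For \<open>j < N\<close> it satisfies |t| \<le> 2 pi N \<delta> \<le>
      pi/3, and cos (pi/3) = 1/2: this is the source of the constant 1/6.\<close>
    define t where "t = 2 * pi * real j * (y - of_int k)"
    have "2 * pi * real j * y = t + 2 * pi * of_int (int j * k)"
      by (simp add: t_def algebra_simps)
    then have "cos (2 * pi * real j * y) = cos t"
      using cos_add[of t "2 * pi * of_int (int j * k)"]
      using cos_int_2pin[of "int j * k"] sin_int_2pin[of "int j * k"] by (simp add: mult_ac)
    moreover have "\<bar>t\<bar> \<le> pi / 3"
    proof -
      have "real j * \<bar>y - of_int k\<bar> \<le> real N * \<delta>"
        using that k by (intro mult_mono) auto
      then have "2 * pi * (real j * \<bar>y - of_int k\<bar>) \<le> 2 * pi * (1/6)"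
        using assms(2) by (intro mult_left_mono) auto
      then show ?thesis by (simp add: t_def abs_mult)
    qed
    then have "cos (pi/3) \<le> cos \<bar>t\<bar>"
      by (intro cos_monotone_0_pi_le) auto
    ultimately show ?thesis by (simp add: cos_60)
  qed
  have "real N / 2 = (\<Sum>j<N. 1/2)" by simp
  also have "\<dots> \<le> (\<Sum>j<N. cos (2 * pi * real j * y))"
    using cos_ge by (intro sum_mono) auto
  also have "\<dots> = Re (\<Sum>j<N. cis (2 * pi * real j * y))" by simp
  also have "\<dots> \<le> norm (\<Sum>j<N. cis (2 * pi * real j * y))" by (rule complex_Re_le_cmod)
  finally show ?thesis .
qed

context
  fixes \<mu> :: "real measure"
  assumes prob: "prob_space \<mu>" and sets_eq[measurable_cong]: "sets \<mu> = sets borel"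
begin

interpretation prob_space \<mu> by (rule prob)

lemma space_eq: "space \<mu> = UNIV"
  using sets_eq_imp_space_eq[OF sets_eq] by simp

lemma fourier_transform_cis: "fourier_transform \<mu> t = (LINT x|\<mu>. cis (- 2 * pi * t * x))"
  by (simp add: fourier_transform_def cis_conv_exp mult_ac)

lemma measurable_cis_affine: "(\<lambda>x. cis (a * x + b)) \<in> borel_measurable \<mu>"
proof -
  have "(\<lambda>x. cis (a * x + b)) \<in> borel_measurable borel"
    by (intro borel_measurable_continuous_onI continuous_intros)
  then show ?thesis using measurable_cong_sets[OF sets_eq refl] by blast
qed

lemma integrable_cis_affine: "integrable \<mu> (\<lambda>x. cis (a * x + b))"
  by (rule integrable_const_bound[where B = 1]) (use measurable_cis_affine in auto)

lemma norm_fourier_transform_le_1: "norm (fourier_transform \<mu> t) \<le> 1"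
proof -
  have "norm (fourier_transform \<mu> t) \<le> (LINT x|\<mu>. norm (cis (- 2 * pi * t * x)))"
    unfolding fourier_transform_cis by (rule integral_norm_bound)
  also have "\<dots> = 1" by (simp add: prob_space)
  finally show ?thesis .
qed

text \<open>The shift \<open>\<gamma>\<close> survives the expansion of the square only in factors
  of modulus 1, so it disappears from the bound.\<close>

lemma integral_norm_sum_cis_square_le:
  "(LINT x|\<mu>. (norm (\<Sum>j<N. cis (2 * pi * real j * (Q * x - \<gamma>))))\<^sup>2)
     \<le> (\<Sum>j<N. \<Sum>l<N. norm (fourier_transform \<mu> (of_int (int l - int j) * Q)))"
proof -
  define S where "S = (\<lambda>x. \<Sum>j<N. cis (2 * pi * real j * (Q * x - \<gamma>)))"
  define c where "c = (\<lambda>j l. cis (2 * pi * (real l - real j) * \<gamma>))"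
  \<comment> \<open>The order \<open>l - j\<close> absorbs the minus sign in the Fourier exponent:
    \<open>cis (a j l * x)\<close> integrates to the transform at
    \<open>(l - j) * Q\<close>.\<close>
  define a where "a = (\<lambda>j l. - 2 * pi * (of_int (int l - int j) * Q))"
  have expand: "complex_of_real ((norm (S x))\<^sup>2) = (\<Sum>j<N. \<Sum>l<N. c j l * cis (a j l * x))" for x
  proof -
    have "complex_of_real ((norm (S x))\<^sup>2) = S x * cnj (S x)" by (rule complex_norm_square)
    also have "\<dots> = (\<Sum>j<N. \<Sum>l<N. cis (2 * pi * real j * (Q * x - \<gamma>))
                                  * cis (- (2 * pi * real l * (Q * x - \<gamma>))))"
      by (simp add: S_def sum_product cis_cnj)
    also have "\<dots> = (\<Sum>j<N. \<Sum>l<N. c j l * cis (a j l * x))"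
      by (intro sum.cong refl) (simp add: cis_mult c_def a_def algebra_simps)
    finally show ?thesis .
  qed
  have int: "integrable \<mu> (\<lambda>x. c j l * cis (a j l * x))" for j l
    using integrable_cis_affine[of "a j l" 0] by simp
  have "complex_of_real (LINT x|\<mu>. (norm (S x))\<^sup>2)
      = (LINT x|\<mu>. (\<Sum>j<N. \<Sum>l<N. c j l * cis (a j l * x)))"
    unfolding expand[symmetric] by (rule integral_complex_of_real[symmetric])
  also have "\<dots> = (\<Sum>j<N. \<Sum>l<N. LINT x|\<mu>. c j l * cis (a j l * x))"
    using int by (simp add: Bochner_Integration.integral_sum)
  also have "\<dots> = (\<Sum>j<N. \<Sum>l<N. c j l * fourier_transform \<mu> (of_int (int l - int j) * Q))"
    by (simp only: fourier_transform_cis a_def integral_mult_right_zero)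
  finally have eq: "complex_of_real (LINT x|\<mu>. (norm (S x))\<^sup>2) = \<dots>" .
  \<comment> \<open>The real integral is passed through the complex norm so that the triangle
    inequality applies to its complex expansion.\<close>
  have "(LINT x|\<mu>. (norm (S x))\<^sup>2) \<le> norm (complex_of_real (LINT x|\<mu>. (norm (S x))\<^sup>2))"
    by simp
  also have "\<dots> \<le> (\<Sum>j<N. \<Sum>l<N. norm (c j l * fourier_transform \<mu> (of_int (int l - int j) * Q)))"
    unfolding eq by (intro sum_norm_le order_refl)
  also have "\<dots> = (\<Sum>j<N. \<Sum>l<N. norm (fourier_transform \<mu> (of_int (int l - int j) * Q)))"
    by (simp add: norm_mult c_def)
  finally show ?thesis by (simp add: S_def)
qed

lemma sets_dist_nearest_int: "{x. dist_nearest_int (Q * x - \<gamma>) \<le> \<delta>} \<in> sets \<mu>"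
proof -
  have "closed {x. dist_nearest_int (Q * x - \<gamma>) \<le> \<delta>}"
    unfolding dist_nearest_int_def by (intro closed_Collect_le continuous_intros)
  then show ?thesis using sets_eq by auto
qed

lemma measure_dist_nearest_int_le_sum:
  assumes "N \<ge> 1" and "real N * \<delta> \<le> 1/6"
  shows "measure \<mu> {x. dist_nearest_int (Q * x - \<gamma>) \<le> \<delta>}
     \<le> 4 / (real N)\<^sup>2 * (\<Sum>j<N. \<Sum>l<N. norm (fourier_transform \<mu> (of_int (int l - int j) * Q)))"
proof -
  define E where "E = {x. dist_nearest_int (Q * x - \<gamma>) \<le> \<delta>}"
  define S where "S = (\<lambda>x. \<Sum>j<N. cis (2 * pi * real j * (Q * x - \<gamma>)))"
  have [measurable]: "S \<in> borel_measurable \<mu>"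
    using measurable_cis_affine[of "2 * pi * real _ * Q" "- (2 * pi * real _ * \<gamma>)"]
    unfolding S_def by (intro borel_measurable_sum) (simp add: algebra_simps)
  have "norm (S x) \<le> real N" for x
    unfolding S_def by (rule order_trans[OF norm_sum]) simp
  then have int: "integrable \<mu> (\<lambda>x. (norm (S x))\<^sup>2)"
    by (intro integrable_const_bound[where B = "(real N)\<^sup>2"]) (auto intro: power_mono)
  have E: "E \<in> sets \<mu>" unfolding E_def by (rule sets_dist_nearest_int)
  have "measure \<mu> E = (LINT x|\<mu>. indicator E x)" using E by (simp add: space_eq)
  also have "\<dots> \<le> (LINT x|\<mu>. 4 / (real N)\<^sup>2 * (norm (S x))\<^sup>2)"
  proof (rule integral_mono)
    fix x
    show "indicator E x \<le> 4 / (real N)\<^sup>2 * (norm (S x))\<^sup>2"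
    proof (cases "x \<in> E")
      case True
      then have "real N / 2 \<le> norm (S x)"
        using norm_sum_cis_ge[OF _ assms(2)] unfolding E_def S_def by blast
      then have "(real N / 2)\<^sup>2 \<le> (norm (S x))\<^sup>2" by (intro power_mono) auto
      then show ?thesis using True assms(1) by (simp add: field_simps power2_eq_square)
    qed auto
  qed (use E int in \<open>auto simp: space_eq less_top[symmetric]\<close>)
  also have "\<dots> = 4 / (real N)\<^sup>2 * (LINT x|\<mu>. (norm (S x))\<^sup>2)" by simp
  also have "\<dots> \<le> 4 / (real N)\<^sup>2
      * (\<Sum>j<N. \<Sum>l<N. norm (fourier_transform \<mu> (of_int (int l - int j) * Q)))"
    unfolding S_def by (intro mult_left_mono integral_norm_sum_cis_square_le) auto
  finally show ?thesis unfolding E_def .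
qed

text \<open>The row bound \<open>T\<close> is the common interface for both Fourier conditions. It
  is required for every \<open>N\<close> because the proof picks \<open>N\<close> from
  \<open>\<delta>\<close>.\<close>

lemma measure_dist_nearest_int_le:
  assumes "\<delta> > 0" and "T \<ge> 0"
    and T: "\<And>N j. j < N \<Longrightarrow> (\<Sum>l\<in>{..<N} - {j}. norm (fourier_transform \<mu> (of_int (int l - int j) * Q)))
                 \<le> real N * T"
  shows "measure \<mu> {x. dist_nearest_int (Q * x - \<gamma>) \<le> \<delta>} \<le> 48 * \<delta> + 4 * T"
proof (cases "6 * \<delta> \<le> 1")
  \<comment> \<open>Here 48 \<delta> > 8, so the trivial bound 1 suffices; the floor below would
    give \<open>N = 0\<close>.\<close>
  case False
  then show ?thesis using prob_le_1[of "{x. dist_nearest_int (Q * x - \<gamma>) \<le> \<delta>}"] assms(2) by linarith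
next
  case True
  \<comment> \<open>The largest \<open>N\<close> with N \<delta> \<le> 1/6. Since N \<ge> 1, 1/(6
    \<delta>) < N + 1 \<le> 2 N, hence 4/N < 48 \<delta>.\<close>
  define N where "N = nat \<lfloor>1 / (6 * \<delta>)\<rfloor>"
  have *: "1 \<le> 1 / (6 * \<delta>)" using True assms(1) by (simp add: field_simps)
  have "0 \<le> \<lfloor>1 / (6 * \<delta>)\<rfloor>" using * by linarith
  then have "real N = of_int \<lfloor>1 / (6 * \<delta>)\<rfloor>" unfolding N_def by (rule of_nat_nat)
  then have N: "real N \<le> 1 / (6 * \<delta>)" "1 / (6 * \<delta>) < real N + 1" by linarith+
  have N1: "N \<ge> 1" using * N(2) by linarith
  have up: "real N * \<delta> \<le> 1/6" using N(1) assms(1) by (simp add: field_simps)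
  have "1 / (6 * \<delta>) < 2 * real N" using N(2) N1 by linarith
  then have low: "4 / real N \<le> 48 * \<delta>" using assms(1) N1 by (simp add: field_simps)
  let ?f = "\<lambda>j l. norm (fourier_transform \<mu> (of_int (int l - int j) * Q))"
  \<comment> \<open>The 1 pays for the diagonal term, the transform at 0. Summed over the
    \<open>N\<close> rows this gives N + N^2 T, which the factor 4/N^2 turns into 4/N + 4 T.\<close>
  have "(\<Sum>l<N. ?f j l) \<le> 1 + real N * T" if "j < N" for j
  proof -
    have "(\<Sum>l<N. ?f j l) = ?f j j + (\<Sum>l\<in>{..<N} - {j}. ?f j l)"
      using that by (intro sum.remove) auto
    then show ?thesis using T[OF that] norm_fourier_transform_le_1[of "of_int (int j - int j) * Q"]
      by linarith
  qed
  then have "(\<Sum>j<N. \<Sum>l<N. ?f j l) \<le> (\<Sum>j<N. 1 + real N * T)" by (intro sum_mono) auto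
  then have "4 / (real N)\<^sup>2 * (\<Sum>j<N. \<Sum>l<N. ?f j l) \<le> 4 / (real N)\<^sup>2 * (\<Sum>j<N. 1 + real N * T)"
    by (intro mult_left_mono) auto
  also have "\<dots> = 4 / real N + 4 * T" using N1 by (simp add: field_simps power2_eq_square)
  finally show ?thesis using measure_dist_nearest_int_le_sum[OF N1 up, of Q \<gamma>] low by linarith
qed

text \<open>Off the diagonal \<open>l - j\<close> is nonzero, so each of the at most
  \<open>N\<close> terms is below the supremum. The bound 1 on the transform makes that supremum a
  genuine upper bound.\<close>

lemma sum_fourier_le_SUP:
  assumes "T = (SUP k\<in>UNIV - {0::int}. norm (fourier_transform \<mu> (of_int k * Q)))"
  shows "T \<ge> 0"
    and "(\<Sum>l\<in>{..<N} - {j}. norm (fourier_transform \<mu> (of_int (int l - int j) * Q))) \<le> real N * T"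
proof -
  have "bdd_above ((\<lambda>k. norm (fourier_transform \<mu> (of_int k * Q))) ` (UNIV - {0::int}))"
    using norm_fourier_transform_le_1 by (intro bdd_aboveI2)
  then have le: "norm (fourier_transform \<mu> (of_int k * Q)) \<le> T" if "k \<noteq> 0" for k :: int
    unfolding assms using that by (intro cSUP_upper) auto
  show T: "T \<ge> 0" using order_trans[OF norm_ge_zero le[of 1]] by simp
  have "(\<Sum>l\<in>{..<N} - {j}. norm (fourier_transform \<mu> (of_int (int l - int j) * Q)))
      \<le> (\<Sum>l\<in>{..<N} - {j}. T)" by (intro sum_mono le) auto
  also have "\<dots> \<le> (\<Sum>l<N. T)" using T by (intro sum_mono2) auto
  finally show "(\<Sum>l\<in>{..<N} - {j}. norm (fourier_transform \<mu> (of_int (int l - int j) * Q)))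
      \<le> real N * T" by simp
qed

text \<open>The values \<open>k = l - j\<close> of one row are distinct with 0 < |k| \<le> N, so the
  factor N/|k| \<ge> 1 inserts the weights; what remains is a finite part of a nonnegative
  series.\<close>

lemma sum_fourier_le_infsum:
  assumes sm: "(\<lambda>k::int. norm (fourier_transform \<mu> (of_int k * Q)) / of_int \<bar>k\<bar>)
            summable_on (UNIV - {0})"
    and T_def: "T = (\<Sum>\<^sub>\<infinity>k\<in>UNIV - {0::int}. norm (fourier_transform \<mu> (of_int k * Q)) / of_int \<bar>k\<bar>)"
    and "j < N"
  shows "(\<Sum>l\<in>{..<N} - {j}. norm (fourier_transform \<mu> (of_int (int l - int j) * Q))) \<le> real N * T"
proof -
  let ?f = "\<lambda>k::int. norm (fourier_transform \<mu> (of_int k * Q))"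
  let ?A = "(\<lambda>l. int l - int j) ` ({..<N} - {j})"
  have "(\<Sum>l\<in>{..<N} - {j}. ?f (int l - int j)) = (\<Sum>k\<in>?A. ?f k)"
    by (subst sum.reindex) (auto simp: inj_on_def)
  also have "\<dots> \<le> (\<Sum>k\<in>?A. real N * (?f k / of_int \<bar>k\<bar>))"
  proof (rule sum_mono)
    fix k assume "k \<in> ?A"
    then have "0 < \<bar>k\<bar>" "\<bar>k\<bar> \<le> int N" using \<open>j < N\<close> by auto
    then have k: "0 < real_of_int \<bar>k\<bar>" "real_of_int \<bar>k\<bar> \<le> real N" by linarith+
    have "?f k * real_of_int \<bar>k\<bar> \<le> ?f k * real N" using k(2) by (intro mult_left_mono) auto
    then show "?f k \<le> real N * (?f k / of_int \<bar>k\<bar>)" using k(1) by (simp add: field_simps)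
  qed
  also have "\<dots> = real N * (\<Sum>k\<in>?A. ?f k / of_int \<bar>k\<bar>)" by (simp add: sum_distrib_left)
  also have "\<dots> \<le> real N * T"
    \<comment> \<open>Summability enters here: a divergent \<open>infsum\<close> defaults to 0 and
      would not dominate its finite parts.\<close>
    unfolding T_def by (intro mult_left_mono finite_sum_le_infsum sm) auto
  finally show ?thesis .
qed

lemma W_set_null:
  assumes "summable (\<lambda>n. measure \<mu> {x. dist_nearest_int (real (q n) * x - \<gamma>) \<le> \<psi> (q n)})"
  shows "W_set q \<gamma> \<psi> \<in> null_sets \<mu>"
proof -
  define E where "E = (\<lambda>n. {x. dist_nearest_int (real (q n) * x - \<gamma>) \<le> \<psi> (q n)})"
  have E: "E n \<in> sets \<mu>" for n unfolding E_def by (rule sets_dist_nearest_int)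
  \<comment> \<open>Infinitely many indices means indices beyond every bound, which is membership in
    the limsup of the sets \<open>E n\<close>, the form Borel-Cantelli needs.\<close>
  have W: "W_set q \<gamma> \<psi> = {0..1} \<inter> limsup E"
    by (auto simp: W_set_def E_def limsup_INF_SUP INFM_nat_le)
  have "summable (\<lambda>n. measure \<mu> (E n))" using assms by (simp add: E_def)
  then have "limsup E \<in> null_sets \<mu>"
    using E by (intro borel_cantelli_limsup1) (auto simp: less_top[symmetric])
  moreover have "{0..1} \<in> sets \<mu>" by (simp add: sets_eq)
  ultimately show ?thesis unfolding W by (rule null_set_Int1)
qed

end

theorem theorem2:
  fixes \<mu> :: "real measure" and F :: "real set" and q :: "nat \<Rightarrow> nat"
    and \<gamma> :: real and \<psi> :: "nat \<Rightarrow> real"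
  assumes "prob_space \<mu>" and "sets \<mu> = sets borel"
    and "F \<subseteq> {0..1}" and "supported_on \<mu> F"
    and "\<And>n. q n \<ge> 1"
    and "\<gamma> \<in> {0..1}"
    and "\<And>m. m \<ge> 1 \<Longrightarrow> 0 < \<psi> m \<and> \<psi> m \<le> 1"
    and "sup_condition \<mu> q \<or> weighted_sum_condition \<mu> q"
    and "summable (\<lambda>n. \<psi> (q n))"
  shows "W_set q \<gamma> \<psi> \<in> null_sets \<mu>"
proof -
  \<comment> \<open>Either condition supplies one summable sequence of row bounds: its
    \<open>n\<close>-th term is the supremum or the weighted sum for \<open>q n\<close>.\<close>
  have "\<exists>T. summable T \<and> (\<forall>n. T n \<ge> 0 \<and> (\<forall>N j. j < N \<longrightarrow>
      (\<Sum>l\<in>{..<N} - {j}. norm (fourier_transform \<mu> (of_int (int l - int j) * real (q n))))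
        \<le> real N * T n))"
    using assms(8)
  proof
    assume "sup_condition \<mu> q"
    then show ?thesis unfolding sup_condition_def
      using sum_fourier_le_SUP[OF assms(1,2) refl] by blast
  next
    assume "weighted_sum_condition \<mu> q"
    then show ?thesis unfolding weighted_sum_condition_def
      using sum_fourier_le_infsum[OF assms(1,2) _ refl]
      by (intro exI conjI allI impI) (auto intro: infsum_nonneg)
  qed
  then obtain T where T: "summable T" "\<And>n. T n \<ge> 0" "\<And>n N j. j < N \<Longrightarrow>
      (\<Sum>l\<in>{..<N} - {j}. norm (fourier_transform \<mu> (of_int (int l - int j) * real (q n))))
        \<le> real N * T n" by blast
  \<comment> \<open>Taken with \<delta> = \<open>\<psi> (q n)\<close>, which is positive because
    \<open>q n \<ge> 1\<close>; both terms of the bound are summable in \<open>n\<close>.\<close>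
  have "measure \<mu> {x. dist_nearest_int (real (q n) * x - \<gamma>) \<le> \<psi> (q n)}
      \<le> 48 * \<psi> (q n) + 4 * T n" for n
    using T(2,3) assms(5,7) by (intro measure_dist_nearest_int_le[OF assms(1,2)]) auto
  moreover have "summable (\<lambda>n. 48 * \<psi> (q n) + 4 * T n)"
    using T(1) assms(9) by (intro summable_add summable_mult)
  ultimately have "summable (\<lambda>n. measure \<mu> {x. dist_nearest_int (real (q n) * x - \<gamma>) \<le> \<psi> (q n)})"
    by (intro summable_comparison_test'[OF \<open>summable (\<lambda>n. 48 * \<psi> (q n) + 4 * T n)\<close>, of 0]) auto
  then show ?thesis by (rule W_set_null[OF assms(1,2)])
qed

end
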